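(* Let $G,H:\mathbb{R}^n\to\mathbb{R}^m$ be continuously differentiable, let $\mathcal{S}=\{x\in\mathbb{R}^n: G(x)\ge 0,\ H(x)\ge 0,\ G(x)^TH(x)=0\}$ be nonempty with $0\notin\mathcal{S}$, and let $\nu>0$. Let $\{x^k\}$ be a sequence generated by the Approximation method (described in the context), and let $x^*$ be an arbitrary accumulation point of $\{x^k\}$. Suppose that MPCC-LICQ holds at $x^*$. Then $x^*$ is an MPCC lifted-stationary point of the problem $(R_\nu)$: $\min_{x\in\mathcal{S}}\Phi(x)$, where $\Phi(x)=\sum_{i=1}^n\min\{1,|x_i|/\nu\}$.
   Context: Inequalities between vectors are componentwise. $\nabla F(x)$ is the transposed Jacobian of $F$ at $x$; $\boldsymbol e_i$ is the $i$th standard basis vector of $\mathbb{R}^n$. For $\sigma>0$, $\mathcal{S}_\sigma=\{x:G(x)\ge0,\ H(x)\ge0,\ G(x)^TH(x)\le\sigma\}$, and $(R_{\nu,\sigma})$ is the problem $\min_{x\in\mathcal{S}_\sigma}\Phi(x)$. For a closed set $\Omega$ and $x\in\Omega$, $\hat{\mathcal{N}}_\Omega(x)=\{u: u^T(y-x)\le o(\|y-x\|)\ \forall y\in\Omega\}$ and $\mathcal{N}_\Omega(x)=\{u:\exists\, y^k\in\Omega,\ y^k\to x,\ u^k\in\hat{\mathcal{N}}_\Omega(y^k),\ u^k\to u\}$ (limiting normal cone). $\partial(\sum_i|x_i|/\nu)$ denotes the (convex) subdifferential of $y\mapsto\sum_i|y_i|/\nu$ at $x$. Let $\theta_1(t)=0$,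 $\theta_2(t)=t/\nu-1$, $\theta_3(t)=-t/\nu-1$, so that $\min\{1,|t|/\nu\}=|t|/\nu-\max\{\theta_1(t),\theta_2(t),\theta_3(t)\}$, and $\mathcal{D}(t)=\{i\in\{1,2,3\}:\theta_i(t)=\max\{\theta_1(t),\theta_2(t),\theta_3(t)\}\}$. Approximation method (Algorithm 1): let $\{\sigma_k\}$ (positive) and $\{\epsilon^k\}$ (nonnegative) be sequences converging to $0$, and choose an arbitrary $x^0\in\mathbb{R}^n$. For $k=1,2,\dots$, solve $(R_{\nu,\sigma_k})$ with initial point $x^{k-1}$ to get $x^k\in\mathcal{S}_{\sigma_k}$ such that there exist $d=(d_1,\dots,d_n)^T$ with $d_i\in\mathcal{D}(x_i^k)$, $i=1,\dots,n$, and $\zeta^k\in\mathbb{R}^n$ with $\|\zeta^k\|\le\epsilon^k$ satisfying $$\zeta^k\in\partial\Big(\sum_{i=1}^n\frac{|x_i^k|}{\nu}\Big)-\sum_{i=1}^n\theta_{d_i}'(x_i^k)\boldsymbol e_i+\mathcal{N}_{\mathcal{S}_{\sigma_k}}(x^k).$$ (A generated sequence is thus any sequence $\{x^k\}$ with these properties.) For $x\in\mathcal{S}$: $\mathcal{I}_G(x)=\{i:G_i(x)=0\}$, $\mathcal{I}_H(x)=\{i:H_i(x)=0\}$, $\mathcal{I}_{0+}(x)=\mathcal{I}_G(x)\setminus\mathcal{I}_H(x)$, $\mathcal{I}_{+0}(x)=\mathcal{I}_H(x)\setminus\mathcal{I}_G(x)$, $\mathcal{I}_{00}(x)=\mathcal{I}_G(x)\cap\mathcal{I}_H(x)$.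 MPCC-LICQ holds at $x^*\in\mathcal{S}$ if the family of gradients $\{\nabla G_i(x^* ):i\in\mathcal{I}_G(x^* )\}\cup\{\nabla H_i(x^* ):i\in\mathcal{I}_H(x^* )\}$ is linearly independent. $x^*\in\mathcal{S}$ is an MPCC lifted-stationary point of $(R_\nu)$ if there exist $d=(d_1,\dots,d_n)^T$ with $d_i\in\mathcal{D}(x_i^* )$, $i=1,\dots,n$, and $u,v\in\mathbb{R}^m$ such that $$0\in\partial\Big(\sum_{i=1}^n\frac{|x_i^*|}{\nu}\Big)-\sum_{i=1}^n\theta_{d_i}'(x_i^* )\boldsymbol e_i-\nabla G(x^* )u-\nabla H(x^* )v,$$ $u_i=0$ for $i\in\mathcal{I}_{+0}(x^* )$, $v_i=0$ for $i\in\mathcal{I}_{0+}(x^* )$, and $u_iv_i\ge0$ for $i\in\mathcal{I}_{00}(x^* )$. *)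

theory Defs
  imports "HOL-Analysis.Analysis" "HOL-Library.Landau_Symbols"
begin

definition cont_differentiable :: "(real^'n \<Rightarrow> real^'m) \<Rightarrow> bool" where
  "cont_differentiable F \<longleftrightarrow>
     (\<forall>x. F differentiable (at x)) \<and> continuous_on UNIV (\<lambda>x. jacobian F (at x))"

text \<open>The transposed Jacobian: its \<open>i\<close>-th column is the gradient of the \<open>i\<close>-th component of \<open>F\<close>.\<close>

definition nabla :: "(real^'n \<Rightarrow> real^'m) \<Rightarrow> real^'n \<Rightarrow> real^'m^'n" where
  "nabla F x = transpose (jacobian F (at x))"

definition subdifferential :: "('a::real_inner \<Rightarrow> real) \<Rightarrow> 'a \<Rightarrow> 'a set" where
  "subdifferential f x = {g. \<forall>y. f y \<ge> f x + g \<bullet> (y - x)}"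

text \<open>Both cones below are meant for closed \<open>\<Omega>\<close> and \<open>x \<in> \<Omega>\<close>.\<close>

definition regular_normal_cone :: "'a::real_inner set \<Rightarrow> 'a \<Rightarrow> 'a set" where
  "regular_normal_cone \<Omega> x =
     {u. \<exists>r. r \<in> o[at x within \<Omega>](\<lambda>y. norm (y - x)) \<and> (\<forall>y\<in>\<Omega>. u \<bullet> (y - x) \<le> r y)}"

definition limiting_normal_cone :: "'a::real_inner set \<Rightarrow> 'a \<Rightarrow> 'a set" where
  "limiting_normal_cone \<Omega> x =
     {u. \<exists>y w. (\<forall>k::nat. y k \<in> \<Omega> \<and> w k \<in> regular_normal_cone \<Omega> (y k))
           \<and> y \<longlonglongrightarrow> x \<and> w \<longlonglongrightarrow> u}"

definition Phi :: "real \<Rightarrow> real^'n \<Rightarrow> real" where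
  "Phi \<nu> x = (\<Sum>i\<in>UNIV. min 1 (\<bar>x $ i\<bar> / \<nu>))"

definition scaled_l1 :: "real \<Rightarrow> real^'n \<Rightarrow> real" where
  "scaled_l1 \<nu> x = (\<Sum>i\<in>UNIV. \<bar>x $ i\<bar> / \<nu>)"

text \<open>Only the indices 1, 2, 3 are used: \<open>active_theta\<close> below admits no others.\<close>

definition theta :: "real \<Rightarrow> nat \<Rightarrow> real \<Rightarrow> real" where
  "theta \<nu> i t = (if i = 1 then 0 else if i = 2 then t / \<nu> - 1 else - t / \<nu> - 1)"

definition max_theta :: "real \<Rightarrow> real \<Rightarrow> real" where
  "max_theta \<nu> t = Max ((\<lambda>i. theta \<nu> i t) ` {1, 2, 3})"

definition active_theta :: "real \<Rightarrow> real \<Rightarrow> nat set" where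
  "active_theta \<nu> t = {i \<in> {1, 2, 3}. theta \<nu> i t = max_theta \<nu> t}"

lemma Phi_dc_decomposition:
  assumes "\<nu> > 0"
  shows "Phi \<nu> x = scaled_l1 \<nu> x - (\<Sum>i\<in>UNIV. max_theta \<nu> (x $ i))"
proof -
  have "min 1 (\<bar>t\<bar> / \<nu>) = \<bar>t\<bar> / \<nu> - max_theta \<nu> t" for t
    using assms by (auto simp: max_theta_def theta_def min_def max_def abs_if field_simps)
  then show ?thesis
    by (simp add: Phi_def scaled_l1_def sum_subtractf)
qed

definition theta_grad :: "real \<Rightarrow> ('n \<Rightarrow> nat) \<Rightarrow> real^'n \<Rightarrow> real^'n" where
  "theta_grad \<nu> d x = (\<Sum>i\<in>UNIV. deriv (theta \<nu> (d i)) (x $ i) *\<^sub>R axis i 1)"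

text \<open>The order on \<open>real^'m\<close> is componentwise.\<close>

definition feasible_set :: "(real^'n \<Rightarrow> real^'m) \<Rightarrow> (real^'n \<Rightarrow> real^'m) \<Rightarrow> (real^'n) set" where
  "feasible_set G H = {x. G x \<ge> 0 \<and> H x \<ge> 0 \<and> G x \<bullet> H x = 0}"

definition relaxed_feasible_set ::
  "(real^'n \<Rightarrow> real^'m) \<Rightarrow> (real^'n \<Rightarrow> real^'m) \<Rightarrow> real \<Rightarrow> (real^'n) set" where
  "relaxed_feasible_set G H \<sigma> = {x. G x \<ge> 0 \<and> H x \<ge> 0 \<and> G x \<bullet> H x \<le> \<sigma>}"

definition zero_indices :: "(real^'n \<Rightarrow> real^'m) \<Rightarrow> real^'n \<Rightarrow> 'm set" where
  "zero_indices F x = {i. F x $ i = 0}"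

text \<open>
  Linear independence of a family, not of the set of its values: repeated vectors
  make the family dependent.
\<close>

definition lin_indep_family :: "('i \<Rightarrow> 'a::real_vector) \<Rightarrow> 'i set \<Rightarrow> bool" where
  "lin_indep_family f I \<longleftrightarrow>
     (\<forall>c. (\<Sum>i\<in>I. c i *\<^sub>R f i) = 0 \<longrightarrow> (\<forall>i\<in>I. c i = 0))"

definition MPCC_LICQ :: "(real^'n \<Rightarrow> real^'m) \<Rightarrow> (real^'n \<Rightarrow> real^'m) \<Rightarrow> real^'n \<Rightarrow> bool" where
  "MPCC_LICQ G H x \<longleftrightarrow>
     lin_indep_family
       (case_sum (\<lambda>i. column i (nabla G x)) (\<lambda>i. column i (nabla H x)))
       (zero_indices G x <+> zero_indices H x)"

definition lifted_stationary ::
  "real \<Rightarrow> (real^'n \<Rightarrow> real^'m) \<Rightarrow> (real^'n \<Rightarrow> real^'m) \<Rightarrow> real^'n \<Rightarrow> bool" where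
  "lifted_stationary \<nu> G H x \<longleftrightarrow>
     x \<in> feasible_set G H \<and>
     (\<exists>d u v.
        (\<forall>i. d i \<in> active_theta \<nu> (x $ i)) \<and>
        (\<exists>g \<in> subdifferential (scaled_l1 \<nu>) x.
           0 = g - theta_grad \<nu> d x - nabla G x *v u - nabla H x *v v) \<and>
        (\<forall>i \<in> zero_indices H x - zero_indices G x. u $ i = 0) \<and>
        (\<forall>i \<in> zero_indices G x - zero_indices H x. v $ i = 0) \<and>
        (\<forall>i \<in> zero_indices G x \<inter> zero_indices H x. u $ i * v $ i \<ge> 0))"

definition approx_stationary ::
  "real \<Rightarrow> (real^'n \<Rightarrow> real^'m) \<Rightarrow> (real^'n \<Rightarrow> real^'m) \<Rightarrow> real \<Rightarrow> real \<Rightarrow> real^'n \<Rightarrow> bool" where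
  "approx_stationary \<nu> G H \<sigma> \<epsilon> x \<longleftrightarrow>
     x \<in> relaxed_feasible_set G H \<sigma> \<and>
     (\<exists>d \<zeta>.
        (\<forall>i. d i \<in> active_theta \<nu> (x $ i)) \<and> norm \<zeta> \<le> \<epsilon> \<and>
        (\<exists>g \<in> subdifferential (scaled_l1 \<nu>) x.
         \<exists>w \<in> limiting_normal_cone (relaxed_feasible_set G H \<sigma>) x.
           \<zeta> = g - theta_grad \<nu> d x + w))"

text \<open>
  The starting point \<open>x 0\<close> is unconstrained. It and every later iterate \<open>x k\<close> only serve to
  initialise the solver for the next subproblem, which imposes no condition on the sequence.
\<close>

definition approximation_method ::
  "real \<Rightarrow> (real^'n \<Rightarrow> real^'m) \<Rightarrow> (real^'n \<Rightarrow> real^'m) \<Rightarrow> (nat \<Rightarrow> real) \<Rightarrow> (nat \<Rightarrow> real)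
     \<Rightarrow> (nat \<Rightarrow> real^'n) \<Rightarrow> bool" where
  "approximation_method \<nu> G H \<sigma> \<epsilon> x \<longleftrightarrow>
     (\<forall>k\<ge>1. \<sigma> k > 0) \<and> \<sigma> \<longlonglongrightarrow> 0 \<and> (\<forall>k\<ge>1. \<epsilon> k \<ge> 0) \<and> \<epsilon> \<longlonglongrightarrow> 0 \<and>
     (\<forall>k\<ge>1. approx_stationary \<nu> G H (\<sigma> k) (\<epsilon> k) (x k))"

end

theory Submission
  imports Defs
begin

text \<open>
  The nonconvex parts of the objective cause no difficulty in the limit: along a subsequence the
  choice \<open>d\<close> of active pieces is constant, and the subgradients of the scaled
  \<open>\<ell>\<^sub>1\<close>-norm are bounded, hence converge to a subgradient at the limit. The
  stationarity equation then makes the normal vectors to the relaxed sets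
  \<open>{x. G x \<ge> 0 \<and> H x \<ge> 0 \<and> G x \<bullet> H x \<le> \<sigma>}\<close> converge as well, and it remains to
  describe the limits of such normals as \<open>\<sigma>\<close> tends to zero. Since a limiting normal is
  approximated by regular normals at nearby points, only regular normals have to be understood.

  At a point \<open>y\<close> close to the limit \<open>x\<^sup>*\<close> the relaxed set satisfies the ordinary linear independence
  constraint qualification, so a regular normal is
  \<open>- \<nabla>G(y) u - \<nabla>H(y) v\<close> with \<open>u = \<lambda> - \<mu> H(y)\<close> and
  \<open>v = \<eta> - \<mu> G(y)\<close>, where the multipliers \<open>\<lambda>\<close>, \<open>\<eta>\<close>, \<open>\<mu>\<close> are nonnegative and complementary to
  their constraints (lemma \<open>relaxed_regular_normal_multipliers\<close>). All that is needed about
  \<open>u\<close> and \<open>v\<close> is contained in two consequences: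
  \<open>u\<^sub>i v\<^sub>i \<ge> 0\<close> and \<open>u\<^sub>i G\<^sub>i(y) = v\<^sub>i H\<^sub>i(y)\<close> for every \<open>i\<close>.
  The inequality is the sign condition of the theorem and passes to the limit.

  The equation is what makes the limit possible. The family of all gradients at \<open>y\<close> may be
  dependent, so \<open>u\<close> and \<open>v\<close> are not controlled directly. But if, say,
  \<open>G\<^sub>i(x\<^sup>*) > 0\<close>, then \<open>u\<^sub>i = v\<^sub>i H\<^sub>i(y) / G\<^sub>i(y)\<close>, and the term
  of \<open>\<nabla>G\<^sub>i\<close> can be merged into that of \<open>\<nabla>H\<^sub>i\<close>. The merged family
  (\<open>reduced_gradients\<close>) tends to the family of active gradients at \<open>x\<^sup>*\<close>, which is
  independent by MPCC-LICQ. Independence is stable under small perturbations and forces the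
  coefficients of a convergent combination to converge
  (lemmas \<open>lin_indep_family_eventually\<close> and \<open>lin_indep_family_coeffs_tendsto\<close>); the
  first fact yields the constraint qualification at \<open>y\<close>, the second the multipliers at \<open>x\<^sup>*\<close>.
\<close>

section \<open>Linearly independent families\<close>

lemma span_image_sum:
  assumes "finite I" and "x \<in> span (f ` I)"
  shows "\<exists>c. x = (\<Sum>i\<in>I. c i *\<^sub>R f i)"
proof -
  let ?T = "{x. \<exists>c. x = (\<Sum>i\<in>I. c i *\<^sub>R f i)}"
  have "subspace ?T"
  proof (rule subspaceI)
    show "0 \<in> ?T" by (auto intro: exI[of _ "\<lambda>_. 0"])
  next
    fix a b assume "a \<in> ?T" "b \<in> ?T"
    then obtain c e where "a = (\<Sum>i\<in>I. c i *\<^sub>R f i)" "b = (\<Sum>i\<in>I. e i *\<^sub>R f i)" by auto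
    then have "a + b = (\<Sum>i\<in>I. (c i + e i) *\<^sub>R f i)"
      by (simp add: sum.distrib scaleR_left_distrib)
    then show "a + b \<in> ?T" by (intro CollectI exI[of _ "\<lambda>i. c i + e i"])
  next
    fix k a assume "a \<in> ?T"
    then obtain c where "a = (\<Sum>i\<in>I. c i *\<^sub>R f i)" by auto
    then have "k *\<^sub>R a = (\<Sum>i\<in>I. (k * c i) *\<^sub>R f i)"
      by (simp add: scaleR_sum_right)
    then show "k *\<^sub>R a \<in> ?T" by (intro CollectI exI[of _ "\<lambda>i. k * c i"])
  qed
  moreover have "f ` I \<subseteq> ?T"
  proof
    fix a assume "a \<in> f ` I"
    then obtain j where j: "j \<in> I" "a = f j" by auto
    then have "a = (\<Sum>i\<in>I. (if i = j then 1 else 0) *\<^sub>R f i)"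
      using assms(1) by (simp add: if_distrib[of "\<lambda>t. t *\<^sub>R _"] sum.delta cong: if_cong)
    then show "a \<in> ?T" by (intro CollectI exI[of _ "\<lambda>i. if i = j then 1 else 0"])
  qed
  ultimately have "span (f ` I) \<subseteq> ?T" by (rule span_minimal[rotated])
  then show ?thesis using assms(2) by auto
qed

text \<open>
  A dual family: \<open>b j\<close> is the component of \<open>f j\<close> orthogonal to the span of the other members,
  suitably scaled. Taking the inner product with \<open>b j\<close> reads off the coefficient of \<open>f j\<close>.
\<close>

lemma lin_indep_family_dual:
  fixes f :: "'i \<Rightarrow> 'a::euclidean_space"
  assumes fin: "finite I" and li: "lin_indep_family f I"
  obtains b where "\<And>i j. i \<in> I \<Longrightarrow> j \<in> I \<Longrightarrow> f i \<bullet> b j = (if i = j then 1 else 0)"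
proof -
  have "\<exists>b. \<forall>i\<in>I. f i \<bullet> b = (if i = j then 1 else 0)" if j: "j \<in> I" for j
  proof -
    obtain y z where y: "y \<in> span (f ` (I - {j}))"
      and z: "\<And>w. w \<in> span (f ` (I - {j})) \<Longrightarrow> orthogonal z w" and yz: "f j = y + z"
      using orthogonal_subspace_decomp_exists[of "f ` (I - {j})" "f j"] by metis
    obtain c where c: "y = (\<Sum>i\<in>I - {j}. c i *\<^sub>R f i)"
      using span_image_sum[OF _ y] fin by auto
    have "z \<noteq> 0"
    proof
      assume "z = 0"
      let ?e = "\<lambda>i. if i = j then - 1 else c i"
      have "(\<Sum>i\<in>I. ?e i *\<^sub>R f i) = - f j + (\<Sum>i\<in>I - {j}. ?e i *\<^sub>R f i)"
        using fin j by (simp add: sum.remove)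
      also have "(\<Sum>i\<in>I - {j}. ?e i *\<^sub>R f i) = y"
        unfolding c by (rule sum.cong) auto
      finally have "(\<Sum>i\<in>I. ?e i *\<^sub>R f i) = 0" using yz \<open>z = 0\<close> by simp
      then have "\<forall>i\<in>I. ?e i = 0" using li[unfolded lin_indep_family_def, rule_format, of ?e] by blast
      then show False using j by force
    qed
    have "f i \<bullet> (z /\<^sub>R (z \<bullet> z)) = (if i = j then 1 else 0)" if "i \<in> I" for i
    proof (cases "i = j")
      case True
      have "y \<bullet> z = 0" using z[OF y] by (simp add: orthogonal_def inner_commute)
      then show ?thesis using True yz \<open>z \<noteq> 0\<close> by (simp add: inner_left_distrib)
    next
      case False
      then have "f i \<in> span (f ` (I - {j}))" using that by (auto intro: span_base)
      then have "f i \<bullet> z = 0" using z by (metis inner_commute orthogonal_def)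
      then show ?thesis using False by simp
    qed
    then show ?thesis by blast
  qed
  then have "\<exists>b. \<forall>j\<in>I. \<forall>i\<in>I. f i \<bullet> b j = (if i = j then 1 else 0)"
    by (intro bchoice) blast
  then show ?thesis using that by blast
qed

lemma inner_dual_sum:
  assumes "finite I" "j \<in> I"
    and "\<And>i j. i \<in> I \<Longrightarrow> j \<in> I \<Longrightarrow> f i \<bullet> b j = (if i = j then 1 else (0::real))"
  shows "(\<Sum>i\<in>I. c i *\<^sub>R f i) \<bullet> b j = c j"
proof -
  have "(\<Sum>i\<in>I. c i *\<^sub>R f i) \<bullet> b j = (\<Sum>i\<in>I. if i = j then c i else 0)"
    unfolding inner_sum_left by (rule sum.cong) (use assms in auto)
  then show ?thesis using assms by simp
qed

text \<open>
  The dual family of the limit bounds the coefficients of any combination of the \<open>f i\<close> by its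
  norm. Half of that bound survives once every \<open>\<phi> y i\<close> is close to \<open>f i\<close>.
\<close>

lemma lin_indep_family_uniform_bound:
  fixes f :: "'i \<Rightarrow> 'a::euclidean_space"
  assumes fin: "finite I" and li: "lin_indep_family f I"
    and lim: "\<And>i. i \<in> I \<Longrightarrow> ((\<lambda>y. \<phi> y i) \<longlongrightarrow> f i) F"
  obtains \<delta> where "\<delta> > 0"
    and "\<forall>\<^sub>F y in F. \<forall>c. \<delta> * (\<Sum>i\<in>I. \<bar>c i\<bar>) \<le> norm (\<Sum>i\<in>I. c i *\<^sub>R \<phi> y i)"
proof -
  obtain b where b: "\<And>i j. i \<in> I \<Longrightarrow> j \<in> I \<Longrightarrow> f i \<bullet> b j = (if i = j then 1 else 0)"
    using lin_indep_family_dual[OF fin li] by blast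
  define M where "M = 1 + (\<Sum>j\<in>I. norm (b j))"
  have M: "M > 0" unfolding M_def by (simp add: add_pos_nonneg sum_nonneg)
  have low: "(\<Sum>i\<in>I. \<bar>c i\<bar>) \<le> M * norm (\<Sum>i\<in>I. c i *\<^sub>R f i)" for c
  proof -
    let ?s = "\<Sum>i\<in>I. c i *\<^sub>R f i"
    have "(\<Sum>i\<in>I. \<bar>c i\<bar>) \<le> (\<Sum>i\<in>I. norm (b i) * norm ?s)"
    proof (rule sum_mono)
      fix j assume "j \<in> I"
      then have "c j = ?s \<bullet> b j" using inner_dual_sum[OF fin _ b] by simp
      then show "\<bar>c j\<bar> \<le> norm (b j) * norm ?s"
        using Cauchy_Schwarz_ineq2[of ?s "b j"] by (simp add: mult.commute)
    qed
    also have "\<dots> \<le> M * norm ?s"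
      unfolding M_def by (simp add: sum_distrib_right distrib_right)
    finally show ?thesis .
  qed
  define \<delta> where "\<delta> = 1 / (2 * M)"
  have \<delta>: "\<delta> > 0" using M by (simp add: \<delta>_def)
  have "\<forall>\<^sub>F y in F. \<forall>i\<in>I. dist (\<phi> y i) (f i) < \<delta>"
    using lim \<delta> fin by (intro eventually_ball_finite) (auto intro: tendstoD)
  then have "\<forall>\<^sub>F y in F. \<forall>c. \<delta> * (\<Sum>i\<in>I. \<bar>c i\<bar>) \<le> norm (\<Sum>i\<in>I. c i *\<^sub>R \<phi> y i)"
  proof eventually_elim
    case (elim y)
    show ?case
    proof
      fix c
      have "norm ((\<Sum>i\<in>I. c i *\<^sub>R f i) - (\<Sum>i\<in>I. c i *\<^sub>R \<phi> y i))
          = norm (\<Sum>i\<in>I. c i *\<^sub>R (f i - \<phi> y i))"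
        by (simp add: sum_subtractf scaleR_diff_right)
      also have "\<dots> \<le> (\<Sum>i\<in>I. \<bar>c i\<bar> * \<delta>)"
      proof (rule sum_norm_le)
        fix i assume "i \<in> I"
        then have "norm (f i - \<phi> y i) \<le> \<delta>"
          using elim by (metis dist_commute dist_norm less_imp_le)
        then show "norm (c i *\<^sub>R (f i - \<phi> y i)) \<le> \<bar>c i\<bar> * \<delta>"
          by (simp add: mult_left_mono)
      qed
      finally have "norm (\<Sum>i\<in>I. c i *\<^sub>R f i)
          \<le> norm (\<Sum>i\<in>I. c i *\<^sub>R \<phi> y i) + \<delta> * (\<Sum>i\<in>I. \<bar>c i\<bar>)"
        using norm_triangle_sub[of "\<Sum>i\<in>I. c i *\<^sub>R f i" "\<Sum>i\<in>I. c i *\<^sub>R \<phi> y i"]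
        by (simp add: sum_distrib_left mult.commute)
      moreover have "2 * \<delta> * (\<Sum>i\<in>I. \<bar>c i\<bar>) \<le> norm (\<Sum>i\<in>I. c i *\<^sub>R f i)"
        using low[of c] M by (simp add: \<delta>_def field_simps)
      ultimately show "\<delta> * (\<Sum>i\<in>I. \<bar>c i\<bar>) \<le> norm (\<Sum>i\<in>I. c i *\<^sub>R \<phi> y i)" by simp
    qed
  qed
  then show ?thesis using that \<delta> by blast
qed

lemma lin_indep_family_eventually:
  fixes f :: "'i \<Rightarrow> 'a::euclidean_space"
  assumes fin: "finite I" and li: "lin_indep_family f I"
    and lim: "\<And>i. i \<in> I \<Longrightarrow> ((\<lambda>y. \<phi> y i) \<longlongrightarrow> f i) F"
  shows "\<forall>\<^sub>F y in F. lin_indep_family (\<phi> y) I"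
proof -
  obtain \<delta> where \<delta>: "\<delta> > 0"
    and bd: "\<forall>\<^sub>F y in F. \<forall>c. \<delta> * (\<Sum>i\<in>I. \<bar>c i\<bar>) \<le> norm (\<Sum>i\<in>I. c i *\<^sub>R \<phi> y i)"
    using lin_indep_family_uniform_bound[OF fin li, of \<phi> F] lim by blast
  from bd show ?thesis
  proof eventually_elim
    case (elim y)
    show ?case unfolding lin_indep_family_def
    proof (intro allI impI)
      fix c assume "(\<Sum>i\<in>I. c i *\<^sub>R \<phi> y i) = 0"
      then have "\<delta> * (\<Sum>i\<in>I. \<bar>c i\<bar>) \<le> 0" using elim by (metis norm_zero)
      then have "(\<Sum>i\<in>I. \<bar>c i\<bar>) \<le> 0" using \<delta> by (simp add: mult_le_0_iff)
      then have "(\<Sum>i\<in>I. \<bar>c i\<bar>) = 0" by (simp add: antisym sum_nonneg)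
      then show "\<forall>i\<in>I. c i = 0" using fin by (simp add: sum_nonneg_eq_0_iff)
    qed
  qed
qed

text \<open>
  By the uniform bound the coefficients stay bounded; pairing the combination with the dual family
  of the limit therefore returns them up to an error that tends to zero.
\<close>

lemma lin_indep_family_coeffs_tendsto:
  fixes f :: "'i \<Rightarrow> 'a::euclidean_space"
  assumes fin: "finite I" and li: "lin_indep_family f I"
    and lim: "\<And>i. i \<in> I \<Longrightarrow> ((\<lambda>y. \<phi> y i) \<longlongrightarrow> f i) F"
    and w: "((\<lambda>y. \<Sum>i\<in>I. c y i *\<^sub>R \<phi> y i) \<longlongrightarrow> w) F"
  obtains c0 where "\<And>i. i \<in> I \<Longrightarrow> ((\<lambda>y. c y i) \<longlongrightarrow> c0 i) F"
proof -
  obtain b where b: "\<And>i j. i \<in> I \<Longrightarrow> j \<in> I \<Longrightarrow> f i \<bullet> b j = (if i = j then 1 else 0)"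
    using lin_indep_family_dual[OF fin li] by blast
  obtain \<delta> where \<delta>: "\<delta> > 0"
    and bd: "\<forall>\<^sub>F y in F. \<forall>c. \<delta> * (\<Sum>i\<in>I. \<bar>c i\<bar>) \<le> norm (\<Sum>i\<in>I. c i *\<^sub>R \<phi> y i)"
    using lin_indep_family_uniform_bound[OF fin li, of \<phi> F] lim by blast
  define M where "M = (norm w + 1) / \<delta>"
  have "\<forall>\<^sub>F y in F. dist (\<Sum>i\<in>I. c y i *\<^sub>R \<phi> y i) w < 1"
    using w by (rule tendstoD) simp
  with bd have cM: "\<forall>\<^sub>F y in F. \<forall>i\<in>I. \<bar>c y i\<bar> \<le> M"
  proof eventually_elim
    case (elim y)
    show ?case
    proof
      fix i assume "i \<in> I"
      then have "\<bar>c y i\<bar> \<le> (\<Sum>i\<in>I. \<bar>c y i\<bar>)"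
        using fin by (intro member_le_sum) auto
      then have "\<delta> * \<bar>c y i\<bar> \<le> \<delta> * (\<Sum>i\<in>I. \<bar>c y i\<bar>)" using \<delta> by simp
      also have "\<dots> \<le> norm (\<Sum>i\<in>I. c y i *\<^sub>R \<phi> y i)" using elim by blast
      also have "\<dots> \<le> norm w + 1"
        using elim(2) norm_triangle_sub[of "\<Sum>i\<in>I. c y i *\<^sub>R \<phi> y i" w] by (simp add: dist_norm)
      finally show "\<bar>c y i\<bar> \<le> M" using \<delta> by (simp add: M_def field_simps)
    qed
  qed
  have "((\<lambda>y. c y j) \<longlongrightarrow> w \<bullet> b j) F" if j: "j \<in> I" for j
  proof -
    have "((\<lambda>y. (\<Sum>i\<in>I. c y i *\<^sub>R \<phi> y i) \<bullet> b j - c y j) \<longlongrightarrow> 0) F"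
    proof (rule Lim_null_comparison)
      show "\<forall>\<^sub>F y in F. norm ((\<Sum>i\<in>I. c y i *\<^sub>R \<phi> y i) \<bullet> b j - c y j)
          \<le> (\<Sum>i\<in>I. M * \<bar>(\<phi> y i - f i) \<bullet> b j\<bar>)"
        using cM
      proof eventually_elim
        case (elim y)
        have "(\<Sum>i\<in>I. c y i *\<^sub>R \<phi> y i) \<bullet> b j - c y j
            = (\<Sum>i\<in>I. c y i *\<^sub>R \<phi> y i) \<bullet> b j - (\<Sum>i\<in>I. c y i *\<^sub>R f i) \<bullet> b j"
          using inner_dual_sum[OF fin j b] by simp
        also have "\<dots> = (\<Sum>i\<in>I. c y i * ((\<phi> y i - f i) \<bullet> b j))"
          by (simp add: inner_sum_left inner_diff_left right_diff_distrib sum_subtractf)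
        finally have "norm ((\<Sum>i\<in>I. c y i *\<^sub>R \<phi> y i) \<bullet> b j - c y j)
            = \<bar>\<Sum>i\<in>I. c y i * ((\<phi> y i - f i) \<bullet> b j)\<bar>" by simp
        also have "\<dots> \<le> (\<Sum>i\<in>I. \<bar>c y i * ((\<phi> y i - f i) \<bullet> b j)\<bar>)" by (rule sum_abs)
        also have "\<dots> \<le> (\<Sum>i\<in>I. M * \<bar>(\<phi> y i - f i) \<bullet> b j\<bar>)"
          using elim by (intro sum_mono) (simp add: abs_mult mult_right_mono)
        finally show ?case .
      qed
      have "((\<lambda>y. \<Sum>i\<in>I. M * \<bar>(\<phi> y i - f i) \<bullet> b j\<bar>)
          \<longlongrightarrow> (\<Sum>i\<in>I. M * \<bar>(f i - f i) \<bullet> b j\<bar>)) F"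
        by (intro tendsto_intros lim)
      then show "((\<lambda>y. \<Sum>i\<in>I. M * \<bar>(\<phi> y i - f i) \<bullet> b j\<bar>) \<longlongrightarrow> 0) F" by simp
    qed
    then have "((\<lambda>y. (\<Sum>i\<in>I. c y i *\<^sub>R \<phi> y i) \<bullet> b j
        - ((\<Sum>i\<in>I. c y i *\<^sub>R \<phi> y i) \<bullet> b j - c y j)) \<longlongrightarrow> w \<bullet> b j - 0) F"
      by (intro tendsto_intros w)
    then show ?thesis by simp
  qed
  then show ?thesis using that[of "\<lambda>j. w \<bullet> b j"] by simp
qed

section \<open>Regular normals under linear independence\<close>

text \<open>
  Moving from \<open>y\<close> in a direction along which every active constraint strictly increases stays in
  \<open>\<Omega>\<close> for a short time, and the defining inequality of the regular normal cone can be divided by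
  that time.
\<close>

lemma regular_normal_strict_direction:
  fixes y :: "'a::real_inner"
  assumes u: "u \<in> regular_normal_cone \<Omega> y"
    and J: "finite J"
    and der: "\<And>j. j \<in> J \<Longrightarrow> (g j has_derivative (\<lambda>h. a j \<bullet> h)) (at y)"
    and act: "\<And>j. j \<in> J \<Longrightarrow> g j y = 0"
    and loc: "\<forall>\<^sub>F z in nhds y. (\<forall>j\<in>J. g j z \<ge> 0) \<longrightarrow> z \<in> \<Omega>"
    and h: "\<And>j. j \<in> J \<Longrightarrow> a j \<bullet> h > 0"
  shows "u \<bullet> h \<le> 0"
proof (cases "h = 0")
  case False
  obtain r where r: "r \<in> o[at y within \<Omega>](\<lambda>z. norm (z - y))"
    and ur: "\<And>z. z \<in> \<Omega> \<Longrightarrow> u \<bullet> (z - y) \<le> r z"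
    using u unfolding regular_normal_cone_def by auto
  have ray: "((\<lambda>t. y + t *\<^sub>R h) \<longlongrightarrow> y) (at_right 0)"
  proof -
    have "((\<lambda>t. y + t *\<^sub>R h) \<longlongrightarrow> y + 0 *\<^sub>R h) (at_right 0)" by (intro tendsto_intros)
    then show ?thesis by simp
  qed
  have pos: "\<forall>\<^sub>F t in at_right 0. g j (y + t *\<^sub>R h) \<ge> 0" if jJ: "j \<in> J" for j
  proof -
    have "((\<lambda>t. y + t *\<^sub>R h) has_derivative (\<lambda>t. t *\<^sub>R h)) (at 0)"
      by (auto intro!: derivative_eq_intros)
    moreover have "(g j has_derivative (\<lambda>h. a j \<bullet> h)) (at (y + 0 *\<^sub>R h))" using der[OF that] by simp
    ultimately have "((\<lambda>t. g j (y + t *\<^sub>R h)) has_derivative (\<lambda>t. a j \<bullet> (t *\<^sub>R h))) (at 0)"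
      by (rule has_derivative_compose)
    then have "((\<lambda>t. g j (y + t *\<^sub>R h)) has_real_derivative a j \<bullet> h) (at 0)"
      unfolding has_field_derivative_def
      by (rule has_derivative_eq_rhs) (simp add: fun_eq_iff mult.commute)
    then obtain d where "d > 0" "\<forall>t>0. t < d \<longrightarrow> g j (y + 0 *\<^sub>R h) < g j (y + (0 + t) *\<^sub>R h)"
      using DERIV_pos_inc_right[OF _ h[OF jJ]] by blast
    then show ?thesis
      unfolding eventually_at_right_field using act[OF that] by (auto intro!: exI[of _ d])
  qed
  have "\<forall>\<^sub>F t in at_right 0. \<forall>j\<in>J. g j (y + t *\<^sub>R h) \<ge> 0"
    using J pos by (intro eventually_ball_finite) auto
  moreover have "\<forall>\<^sub>F t in at_right 0. (\<forall>j\<in>J. g j (y + t *\<^sub>R h) \<ge> 0) \<longrightarrow> y + t *\<^sub>R h \<in> \<Omega>"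
    using ray loc by (rule eventually_compose_filterlim[rotated])
  ultimately have in\<Omega>: "\<forall>\<^sub>F t in at_right 0. y + t *\<^sub>R h \<in> \<Omega>"
    by eventually_elim auto
  have tpos: "\<forall>\<^sub>F t in at_right (0::real). t > 0" by (rule eventually_at_right_less)
  have "filterlim (\<lambda>t. y + t *\<^sub>R h) (at y within \<Omega>) (at_right 0)"
    unfolding filterlim_at using ray in\<Omega> tpos False
    by (auto elim: eventually_elim2)
  then have "(\<lambda>t. r (y + t *\<^sub>R h)) \<in> o[at_right 0](\<lambda>t. norm (y + t *\<^sub>R h - y))"
    using landau_o.small.compose[OF r] by blast
  moreover have "(\<lambda>t. norm (y + t *\<^sub>R h - y)) \<in> O[at_right 0](\<lambda>t. t)"
    by (rule bigoI[of _ "norm h"]) (simp add: mult.commute)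
  ultimately have "(\<lambda>t. r (y + t *\<^sub>R h)) \<in> o[at_right 0](\<lambda>t. t)"
    by (rule landau_o.small_big_trans)
  then have "((\<lambda>t. r (y + t *\<^sub>R h) / t) \<longlongrightarrow> 0) (at_right 0)"
    by (rule smalloD_tendsto)
  moreover have "\<forall>\<^sub>F t in at_right 0. u \<bullet> h \<le> r (y + t *\<^sub>R h) / t"
    using in\<Omega> tpos
  proof eventually_elim
    case (elim t)
    then have "t * (u \<bullet> h) \<le> r (y + t *\<^sub>R h)" using ur[of "y + t *\<^sub>R h"] by simp
    then show ?case using elim by (simp add: field_simps)
  qed
  ultimately show ?thesis
    by (intro tendsto_lowerbound[of _ 0 "at_right 0"]) auto
qed simp

text \<open>
  Under linear independence no theorem of the alternative is needed: the sum of the dual family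
  is a strictly feasible direction, which extends the previous lemma to all linearised feasible
  directions. The directions orthogonal to all active gradients show that \<open>u\<close> lies in their span,
  and the members of the dual family give the signs of its coefficients.
\<close>

lemma regular_normal_multipliers:
  fixes y :: "'a::euclidean_space"
  assumes u: "u \<in> regular_normal_cone \<Omega> y"
    and J: "finite J"
    and der: "\<And>j. j \<in> J \<Longrightarrow> (g j has_derivative (\<lambda>h. a j \<bullet> h)) (at y)"
    and act: "\<And>j. j \<in> J \<Longrightarrow> g j y = 0"
    and loc: "\<forall>\<^sub>F z in nhds y. (\<forall>j\<in>J. g j z \<ge> 0) \<longrightarrow> z \<in> \<Omega>"
    and li: "lin_indep_family a J"
  obtains c where "\<And>j. j \<in> J \<Longrightarrow> c j \<ge> 0" and "u = - (\<Sum>j\<in>J. c j *\<^sub>R a j)"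
proof -
  obtain b where b: "\<And>i j. i \<in> J \<Longrightarrow> j \<in> J \<Longrightarrow> a i \<bullet> b j = (if i = j then 1 else 0)"
    using lin_indep_family_dual[OF J li] by blast
  have weak: "u \<bullet> h \<le> 0" if h: "\<And>j. j \<in> J \<Longrightarrow> a j \<bullet> h \<ge> 0" for h
  proof -
    \<comment> \<open>Shift \<open>h\<close> by a small multiple of a direction that strictly increases every constraint.\<close>
    define s where "s = (\<Sum>j\<in>J. b j)"
    have s: "a i \<bullet> s = 1" if "i \<in> J" for i
    proof -
      have "a i \<bullet> s = (\<Sum>j\<in>J. if j = i then 1 else 0)"
        unfolding s_def inner_sum_right by (rule sum.cong) (use b that in auto)
      then show ?thesis using J that by simp
    qed
    have "\<forall>\<^sub>F t in at_right 0. u \<bullet> (h + t *\<^sub>R s) \<le> 0"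
    proof -
      have "\<forall>\<^sub>F t in at_right (0::real). t > 0" by (rule eventually_at_right_less)
      then show ?thesis
      proof eventually_elim
        case (elim t)
        show ?case
        proof (rule regular_normal_strict_direction[OF u J der act loc])
          fix j assume "j \<in> J"
          then show "a j \<bullet> (h + t *\<^sub>R s) > 0"
            using h[of j] s[of j] elim by (simp add: inner_right_distrib)
        qed auto
      qed
    qed
    moreover have "((\<lambda>t. u \<bullet> (h + t *\<^sub>R s)) \<longlongrightarrow> u \<bullet> (h + 0 *\<^sub>R s)) (at_right 0)"
      by (intro tendsto_intros)
    ultimately have "u \<bullet> (h + 0 *\<^sub>R s) \<le> 0"
      by (intro tendsto_upperbound[of _ _ "at_right 0"]) auto
    then show ?thesis by simp
  qed
  obtain p z where p: "p \<in> span (a ` J)"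
    and z: "\<And>w. w \<in> span (a ` J) \<Longrightarrow> orthogonal z w" and pz: "u = p + z"
    using orthogonal_subspace_decomp_exists[of "a ` J" u] by metis
  have "a j \<bullet> z = 0" if "j \<in> J" for j
    using z[of "a j"] that by (simp add: span_base orthogonal_def inner_commute)
  then have "u \<bullet> z \<le> 0" by (intro weak) simp
  moreover have "p \<bullet> z = 0" using z[OF p] by (simp add: orthogonal_def inner_commute)
  ultimately have "z = 0" using pz by (simp add: inner_left_distrib) (metis inner_gt_zero_iff not_le)
  obtain e where e: "p = (\<Sum>i\<in>J. e i *\<^sub>R a i)" using span_image_sum[OF J p] by blast
  have "e j \<le> 0" if j: "j \<in> J" for j
  proof -
    have "u \<bullet> b j \<le> 0" using b j by (intro weak) auto
    then show ?thesis using inner_dual_sum[OF J j b, of e] e pz \<open>z = 0\<close> by simp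
  qed
  then show ?thesis
    using that[of "\<lambda>j. - e j"] e pz \<open>z = 0\<close> by (simp add: sum_negf)
qed

section \<open>Regular normals of the relaxed feasible sets\<close>

lemma cont_differentiable_component:
  assumes "cont_differentiable F"
  shows "((\<lambda>z. F z $ i) has_derivative (\<lambda>h. column i (nabla F y) \<bullet> h)) (at y)"
proof -
  have "(F has_derivative (\<lambda>h. jacobian F (at y) *v h)) (at y)"
    using assms jacobian_works unfolding cont_differentiable_def by blast
  then have "((\<lambda>z. F z $ i) has_derivative (\<lambda>h. (jacobian F (at y) *v h) $ i)) (at y)"
    by (rule bounded_linear.has_derivative[OF bounded_linear_vec_nth])
  moreover have "(jacobian F (at y) *v h) $ i = column i (nabla F y) \<bullet> h" for h
    by (simp add: nabla_def column_def transpose_def matrix_vector_mult_def inner_vec_def)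
  ultimately show ?thesis by simp
qed

lemma cont_differentiable_tendsto:
  assumes "cont_differentiable F"
  shows "((\<lambda>z. F z) \<longlongrightarrow> F y) (nhds y)"
    and "((\<lambda>z. column i (nabla F z)) \<longlongrightarrow> column i (nabla F y)) (nhds y)"
proof -
  have "isCont F y"
    using assms unfolding cont_differentiable_def by (simp add: differentiable_imp_continuous_within)
  then show "((\<lambda>z. F z) \<longlongrightarrow> F y) (nhds y)"
    by (simp add: continuous_within tendsto_nhds_iff)
  have "isCont (\<lambda>z. jacobian F (at z)) y"
    using assms unfolding cont_differentiable_def by (simp add: continuous_on_eq_continuous_at)
  then have "((\<lambda>z. jacobian F (at z)) \<longlongrightarrow> jacobian F (at y)) (nhds y)"
    by (simp add: continuous_within tendsto_nhds_iff)
  then have "((\<lambda>z. jacobian F (at z) $ i) \<longlongrightarrow> jacobian F (at y) $ i) (nhds y)"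
    by (rule tendsto_vec_nth)
  moreover have "column i (nabla F z) = jacobian F (at z) $ i" for z
    by (simp add: nabla_def column_def transpose_def vec_eq_iff)
  ultimately show "((\<lambda>z. column i (nabla F z)) \<longlongrightarrow> column i (nabla F y)) (nhds y)" by simp
qed

lemma nabla_mult_vec: "nabla F y *v u = (\<Sum>i\<in>UNIV. u $ i *\<^sub>R column i (nabla F y))"
  by (simp add: matrix_mult_sum scalar_mult_eq_scaleR)

text \<open>
  The gradients, at \<open>y\<close>, of the constraints active at \<open>xs\<close>. If only one of \<open>G\<^sub>i\<close> and \<open>H\<^sub>i\<close>
  is active at \<open>xs\<close>, its gradient is merged with that of the other one, with the weight dictated
  by \<open>u\<^sub>i G\<^sub>i(y) = v\<^sub>i H\<^sub>i(y)\<close>. For continuous \<open>G\<close> and \<open>H\<close> the weight vanishes as \<open>y\<close> tends to \<open>xs\<close>.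
\<close>

definition reduced_gradients ::
  "(real^'n \<Rightarrow> real^'m) \<Rightarrow> (real^'n \<Rightarrow> real^'m) \<Rightarrow> real^'n \<Rightarrow> real^'n \<Rightarrow> 'm + 'm \<Rightarrow> real^'n" where
  "reduced_gradients G H xs y = case_sum
     (\<lambda>i. column i (nabla G y)
        + (if H xs $ i = 0 then 0 else (G y $ i / H y $ i) *\<^sub>R column i (nabla H y)))
     (\<lambda>i. column i (nabla H y)
        + (if G xs $ i = 0 then 0 else (H y $ i / G y $ i) *\<^sub>R column i (nabla G y)))"

text \<open>
  Pair by pair: for an index at which \<open>G\<close> is inactive at \<open>xs\<close>, the hypothesis \<open>uv\<close> expresses
  \<open>u\<^sub>i\<close> through \<open>v\<^sub>i\<close>, and symmetrically. The combination on the right is thus governed by a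
  family that can be independent even if the gradients at \<open>y\<close> are not.
\<close>

lemma sum_reduced_gradients:
  fixes G H :: "real^'n \<Rightarrow> real^'m"
  assumes comp: "\<And>i. G xs $ i = 0 \<or> H xs $ i = 0"
    and G: "\<And>i. G xs $ i \<noteq> 0 \<Longrightarrow> G y $ i \<noteq> 0" and H: "\<And>i. H xs $ i \<noteq> 0 \<Longrightarrow> H y $ i \<noteq> 0"
    and uv: "\<And>i. u i * G y $ i = v i * H y $ i"
  shows "(\<Sum>j\<in>zero_indices G xs <+> zero_indices H xs.
      case_sum u v j *\<^sub>R reduced_gradients G H xs y j)
    = (\<Sum>i\<in>UNIV. u i *\<^sub>R column i (nabla G y)) + (\<Sum>i\<in>UNIV. v i *\<^sub>R column i (nabla H y))"
    (is "?L = _")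
proof -
  let ?R = "reduced_gradients G H xs y"
  have "?L = (\<Sum>i\<in>zero_indices G xs. u i *\<^sub>R ?R (Inl i)) + (\<Sum>i\<in>zero_indices H xs. v i *\<^sub>R ?R (Inr i))"
    by (simp add: sum.Plus)
  also have "\<dots> = (\<Sum>i\<in>UNIV. (if G xs $ i = 0 then u i *\<^sub>R ?R (Inl i) else 0)
      + (if H xs $ i = 0 then v i *\<^sub>R ?R (Inr i) else 0))"
    by (simp add: zero_indices_def sum.distrib sum.If_cases)
  also have "\<dots> = (\<Sum>i\<in>UNIV. u i *\<^sub>R column i (nabla G y) + v i *\<^sub>R column i (nabla H y))"
  proof (rule sum.cong)
    fix i
    consider "G xs $ i = 0" "H xs $ i = 0" | "G xs $ i \<noteq> 0" "H xs $ i = 0"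
      | "G xs $ i = 0" "H xs $ i \<noteq> 0"
      using comp by blast
    then show "(if G xs $ i = 0 then u i *\<^sub>R ?R (Inl i) else 0)
        + (if H xs $ i = 0 then v i *\<^sub>R ?R (Inr i) else 0)
      = u i *\<^sub>R column i (nabla G y) + v i *\<^sub>R column i (nabla H y)"
    proof cases
      case 1
      then show ?thesis by (simp add: reduced_gradients_def)
    next
      case 2
      then have "v i * (H y $ i / G y $ i) = u i" using uv[of i] G[of i] by (simp add: field_simps)
      then show ?thesis using 2 by (simp add: reduced_gradients_def scaleR_add_right)
    next
      case 3
      then have "u i * (G y $ i / H y $ i) = v i" using uv[of i] H[of i] by (simp add: field_simps)
      then show ?thesis using 3 by (simp add: reduced_gradients_def scaleR_add_right)
    qed
  qed simp
  finally show ?thesis by (simp add: sum.distrib)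
qed

lemma reduced_gradients_tendsto:
  fixes G H :: "real^'n \<Rightarrow> real^'m"
  assumes "cont_differentiable G" "cont_differentiable H"
    and comp: "\<And>i. G xs $ i = 0 \<or> H xs $ i = 0"
    and j: "j \<in> zero_indices G xs <+> zero_indices H xs"
  shows "((\<lambda>y. reduced_gradients G H xs y j) \<longlongrightarrow>
    case_sum (\<lambda>i. column i (nabla G xs)) (\<lambda>i. column i (nabla H xs)) j) (nhds xs)"
proof -
  note lims = cont_differentiable_tendsto[OF assms(1), where y = xs]
    cont_differentiable_tendsto[OF assms(2), where y = xs]
  show ?thesis
  proof (cases j)
    case (Inl i)
    have "G xs $ i = 0" using j Inl by (auto simp: zero_indices_def)
    have "((\<lambda>y. column i (nabla G y) + (G y $ i / H y $ i) *\<^sub>R column i (nabla H y)) \<longlongrightarrow>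
      column i (nabla G xs) + (G xs $ i / H xs $ i) *\<^sub>R column i (nabla H xs)) (nhds xs)"
      if "H xs $ i \<noteq> 0"
      by (intro tendsto_intros lims that)
    then show ?thesis using Inl \<open>G xs $ i = 0\<close> lims(2)[of i]
      by (cases "H xs $ i = 0") (simp_all add: reduced_gradients_def)
  next
    case (Inr i)
    have "H xs $ i = 0" using j Inr by (auto simp: zero_indices_def)
    have "((\<lambda>y. column i (nabla H y) + (H y $ i / G y $ i) *\<^sub>R column i (nabla G y)) \<longlongrightarrow>
      column i (nabla H xs) + (H xs $ i / G xs $ i) *\<^sub>R column i (nabla G xs)) (nhds xs)"
      if "G xs $ i \<noteq> 0"
      by (intro tendsto_intros lims that)
    then show ?thesis using Inr \<open>H xs $ i = 0\<close> lims(4)[of i]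
      by (cases "G xs $ i = 0") (simp_all add: reduced_gradients_def)
  qed
qed

text \<open>
  Linear independence of the active gradients of the relaxed set comes down to that of the reduced
  family: in a vanishing combination with coefficients \<open>lam\<close>, \<open>eta\<close>, \<open>\<mu>\<close>, the vectors
  \<open>u = lam - \<mu> H(y)\<close> and \<open>v = eta - \<mu> G(y)\<close> satisfy \<open>u\<^sub>i G\<^sub>i(y) = v\<^sub>i H\<^sub>i(y)\<close>, so
  they vanish on the indices active at \<open>xs\<close>. If the product constraint is active, then some
  \<open>G\<^sub>i(y) H\<^sub>i(y)\<close> is nonzero because \<open>\<sigma> > 0\<close>; there \<open>lam\<close> and \<open>eta\<close> are zero, which leaves
  \<open>\<mu> = 0\<close>. The same two formulas give the two relations between the multipliers.
\<close>

lemma relaxed_regular_normal_multipliers: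
  fixes G H :: "real^'n \<Rightarrow> real^'m"
  assumes cdG: "cont_differentiable G" and cdH: "cont_differentiable H"
    and comp: "\<And>i. G xs $ i = 0 \<or> H xs $ i = 0"
    and Gy: "\<And>i. G xs $ i \<noteq> 0 \<Longrightarrow> G y $ i \<noteq> 0" and Hy: "\<And>i. H xs $ i \<noteq> 0 \<Longrightarrow> H y $ i \<noteq> 0"
    and li: "lin_indep_family (reduced_gradients G H xs y) (zero_indices G xs <+> zero_indices H xs)"
    and \<sigma>: "\<sigma> > 0" and y: "y \<in> relaxed_feasible_set G H \<sigma>"
    and w: "w \<in> regular_normal_cone (relaxed_feasible_set G H \<sigma>) y"
  obtains u v :: "real^'m" where "w = - (nabla G y *v u) - nabla H y *v v"
    and "\<And>i. u $ i * G y $ i = v $ i * H y $ i" and "\<And>i. u $ i * v $ i \<ge> 0"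
proof -
  have G0: "G y $ i \<ge> 0" and H0: "H y $ i \<ge> 0" for i
    using y by (auto simp: relaxed_feasible_set_def less_eq_vec_def)
  define q where "q z = \<sigma> - G z \<bullet> H z" for z
  \<comment> \<open>The active constraints: \<open>None\<close> stands for the product constraint, \<open>Some (Inl i)\<close> and
    \<open>Some (Inr i)\<close> for the sign constraints on \<open>G\<close> and \<open>H\<close>.\<close>
  define J :: "('m + 'm) option set" where
    "J = Some ` (zero_indices G y <+> zero_indices H y) \<union> (if q y = 0 then {None} else {})"
  define g where "g j z = (case j of None \<Rightarrow> q z
      | Some s \<Rightarrow> case_sum (\<lambda>i. G z $ i) (\<lambda>i. H z $ i) s)" for j z
  define aq where "aq = - (\<Sum>i\<in>UNIV. H y $ i *\<^sub>R column i (nabla G y) + G y $ i *\<^sub>R column i (nabla H y))"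
  define a where "a j = (case j of None \<Rightarrow> aq
      | Some s \<Rightarrow> case_sum (\<lambda>i. column i (nabla G y)) (\<lambda>i. column i (nabla H y)) s)" for j
  have sumJ: "(\<Sum>j\<in>J. c j *\<^sub>R a j)
      = (\<Sum>i\<in>UNIV. (lam i - \<mu> * H y $ i) *\<^sub>R column i (nabla G y))
      + (\<Sum>i\<in>UNIV. (eta i - \<mu> * G y $ i) *\<^sub>R column i (nabla H y))"
    if "\<And>i. lam i = (if G y $ i = 0 then c (Some (Inl i)) else 0)"
      "\<And>i. eta i = (if H y $ i = 0 then c (Some (Inr i)) else 0)"
      "\<mu> = (if q y = 0 then c None else 0)" for c lam eta \<mu>
  proof -
    have "(\<Sum>j\<in>J. c j *\<^sub>R a j)
        = (\<Sum>j\<in>Some ` (zero_indices G y <+> zero_indices H y). c j *\<^sub>R a j) + \<mu> *\<^sub>R aq"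
      unfolding J_def that(3) by (subst sum.union_disjoint) (auto simp: a_def)
    also have "(\<Sum>j\<in>Some ` (zero_indices G y <+> zero_indices H y). c j *\<^sub>R a j)
        = (\<Sum>i\<in>zero_indices G y. c (Some (Inl i)) *\<^sub>R column i (nabla G y))
        + (\<Sum>i\<in>zero_indices H y. c (Some (Inr i)) *\<^sub>R column i (nabla H y))"
      by (subst sum.reindex) (auto simp: sum.Plus a_def)
    also have "\<dots> = (\<Sum>i\<in>UNIV. lam i *\<^sub>R column i (nabla G y))
        + (\<Sum>i\<in>UNIV. eta i *\<^sub>R column i (nabla H y))"
      unfolding that(1,2)
      by (simp add: zero_indices_def if_distrib[of "\<lambda>t. t *\<^sub>R _"] sum.If_cases cong: if_cong)
    finally show ?thesis
      unfolding aq_def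
      by (simp add: scaleR_diff_left sum.distrib sum_subtractf scaleR_sum_right scaleR_add_right
          scaleR_diff_right)
  qed
  have "lin_indep_family a J"
    unfolding lin_indep_family_def
  proof (intro allI impI)
    fix c assume c0: "(\<Sum>j\<in>J. c j *\<^sub>R a j) = 0"
    define lam where "lam i = (if G y $ i = 0 then c (Some (Inl i)) else 0)" for i
    define eta where "eta i = (if H y $ i = 0 then c (Some (Inr i)) else 0)" for i
    define \<mu> where "\<mu> = (if q y = 0 then c None else 0)"
    let ?u = "\<lambda>i. lam i - \<mu> * H y $ i"
    let ?v = "\<lambda>i. eta i - \<mu> * G y $ i"
    have "(\<Sum>j\<in>zero_indices G xs <+> zero_indices H xs.
        case_sum ?u ?v j *\<^sub>R reduced_gradients G H xs y j) = 0"
      using c0 sumJ[of lam c eta \<mu>] lam_def eta_def \<mu>_def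
      by (subst sum_reduced_gradients[OF comp Gy Hy]) (auto simp: algebra_simps)
    then have *: "\<forall>j\<in>zero_indices G xs <+> zero_indices H xs. case_sum ?u ?v j = 0"
      using li unfolding lin_indep_family_def by blast
    have u0: "?u i = 0" if "G xs $ i = 0" for i
      using bspec[OF *, of "Inl i"] that by (simp add: zero_indices_def InlI)
    have v0: "?v i = 0" if "H xs $ i = 0" for i
      using bspec[OF *, of "Inr i"] that by (simp add: zero_indices_def InrI)
    have "\<mu> = 0"
    proof (cases "q y = 0")
      case True
      then have "(\<Sum>i\<in>UNIV. G y $ i * H y $ i) \<noteq> 0" using \<sigma> by (simp add: q_def inner_vec_def)
      then obtain i where "G y $ i * H y $ i \<noteq> 0" by (meson sum.neutral)
      then have "G y $ i \<noteq> 0" "H y $ i \<noteq> 0" by auto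
      then show ?thesis using comp[of i] u0[of i] v0[of i] by (auto simp: lam_def eta_def)
    qed (simp add: \<mu>_def)
    show "\<forall>j\<in>J. c j = 0"
    proof
      fix j assume "j \<in> J"
      then consider i where "j = Some (Inl i)" "G y $ i = 0"
        | i where "j = Some (Inr i)" "H y $ i = 0" | "j = None" "q y = 0"
        unfolding J_def zero_indices_def by (auto split: if_splits)
      then show "c j = 0"
      proof cases
        case 1
        then show ?thesis using Gy[of i] u0[of i] \<open>\<mu> = 0\<close> by (auto simp: lam_def)
      next
        case 2
        then show ?thesis using Hy[of i] v0[of i] \<open>\<mu> = 0\<close> by (auto simp: eta_def)
      next
        case 3
        then show ?thesis using \<open>\<mu> = 0\<close> by (simp add: \<mu>_def)
      qed
    qed
  qed
  moreover have "finite J" by simp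
  moreover have "(g j has_derivative (\<lambda>h. a j \<bullet> h)) (at y)" if "j \<in> J" for j
  proof (cases j)
    case None
    have "((\<lambda>z. \<sigma> - (\<Sum>i\<in>UNIV. G z $ i * H z $ i)) has_derivative
        (\<lambda>h. 0 - (\<Sum>i\<in>UNIV. G y $ i * (column i (nabla H y) \<bullet> h) + (column i (nabla G y) \<bullet> h) * H y $ i))) (at y)"
      by (intro derivative_intros cont_differentiable_component cdG cdH)
    moreover have "q = (\<lambda>z. \<sigma> - (\<Sum>i\<in>UNIV. G z $ i * H z $ i))"
      by (simp add: q_def inner_vec_def fun_eq_iff)
    moreover have "0 - (\<Sum>i\<in>UNIV. G y $ i * (column i (nabla H y) \<bullet> h) + (column i (nabla G y) \<bullet> h) * H y $ i)
        = aq \<bullet> h" for h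
      by (simp add: aq_def inner_sum_left inner_left_distrib algebra_simps)
    moreover have "g j = q" "a j = aq" using None by (auto simp: g_def a_def)
    ultimately show ?thesis by simp
  next
    case (Some s)
    then show ?thesis
      using cont_differentiable_component[OF cdG] cont_differentiable_component[OF cdH]
      by (cases s) (simp_all add: g_def[abs_def] a_def)
  qed
  moreover have "g j y = 0" if "j \<in> J" for j
    using that by (auto simp: J_def g_def zero_indices_def split: if_splits)
  moreover have "\<forall>\<^sub>F z in nhds y. (\<forall>j\<in>J. g j z \<ge> 0) \<longrightarrow> z \<in> relaxed_feasible_set G H \<sigma>"
  proof -
    note tG = cont_differentiable_tendsto(1)[OF cdG, of y]
      and tH = cont_differentiable_tendsto(1)[OF cdH, of y]
    have "\<forall>\<^sub>F z in nhds y. G y $ i \<noteq> 0 \<longrightarrow> G z $ i > 0" for i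
    proof (cases "G y $ i = 0")
      case False
      then have "G y $ i > 0" using G0[of i] by simp
      then have "\<forall>\<^sub>F z in nhds y. G z $ i > 0"
        by (rule order_tendstoD(1)[OF tendsto_vec_nth[OF tG]])
      then show ?thesis by eventually_elim simp
    qed simp
    then have 1: "\<forall>\<^sub>F z in nhds y. \<forall>i. G y $ i \<noteq> 0 \<longrightarrow> G z $ i > 0"
      by (rule eventually_all_finite)
    have "\<forall>\<^sub>F z in nhds y. H y $ i \<noteq> 0 \<longrightarrow> H z $ i > 0" for i
    proof (cases "H y $ i = 0")
      case False
      then have "H y $ i > 0" using H0[of i] by simp
      then have "\<forall>\<^sub>F z in nhds y. H z $ i > 0"
        by (rule order_tendstoD(1)[OF tendsto_vec_nth[OF tH]])
      then show ?thesis by eventually_elim simp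
    qed simp
    then have 2: "\<forall>\<^sub>F z in nhds y. \<forall>i. H y $ i \<noteq> 0 \<longrightarrow> H z $ i > 0"
      by (rule eventually_all_finite)
    have 3: "\<forall>\<^sub>F z in nhds y. q y \<noteq> 0 \<longrightarrow> q z > 0"
    proof (cases "q y = 0")
      case False
      then have "q y > 0" using y by (simp add: q_def relaxed_feasible_set_def)
      moreover have "(q \<longlongrightarrow> q y) (nhds y)" unfolding q_def by (intro tendsto_intros tG tH)
      ultimately have "\<forall>\<^sub>F z in nhds y. q z > 0" by (intro order_tendstoD(1)[of q "q y"])
      then show ?thesis by eventually_elim simp
    qed simp
    from 1 2 3 show ?thesis
    proof eventually_elim
      case (elim z)
      show ?case
      proof
        assume J: "\<forall>j\<in>J. g j z \<ge> 0"
        have "G z $ i \<ge> 0" for i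
        proof (cases "G y $ i = 0")
          case True
          then have "Some (Inl i) \<in> J" by (simp add: J_def zero_indices_def InlI)
          from bspec[OF J this] show ?thesis by (simp add: g_def)
        qed (use elim in \<open>auto intro: less_imp_le\<close>)
        moreover have "H z $ i \<ge> 0" for i
        proof (cases "H y $ i = 0")
          case True
          then have "Some (Inr i) \<in> J" by (simp add: J_def zero_indices_def InrI)
          from bspec[OF J this] show ?thesis by (simp add: g_def)
        qed (use elim in \<open>auto intro: less_imp_le\<close>)
        moreover have "q z \<ge> 0"
        proof (cases "q y = 0")
          case True
          then have "None \<in> J" by (simp add: J_def)
          from bspec[OF J this] show ?thesis by (simp add: g_def)
        qed (use elim in auto)
        ultimately show "z \<in> relaxed_feasible_set G H \<sigma>"
          by (simp add: relaxed_feasible_set_def less_eq_vec_def q_def)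
      qed
    qed
  qed
  ultimately obtain c where c: "\<And>j. j \<in> J \<Longrightarrow> c j \<ge> 0" and wc: "w = - (\<Sum>j\<in>J. c j *\<^sub>R a j)"
    using regular_normal_multipliers[OF w, of J g a] by metis
  define lam where "lam i = (if G y $ i = 0 then c (Some (Inl i)) else 0)" for i
  define eta where "eta i = (if H y $ i = 0 then c (Some (Inr i)) else 0)" for i
  define \<mu> where "\<mu> = (if q y = 0 then c None else 0)"
  have lam: "lam i \<ge> 0" "lam i = 0 \<or> G y $ i = 0" for i
    using c[of "Some (Inl i)"] by (auto simp: lam_def J_def zero_indices_def InlI)
  have eta: "eta i \<ge> 0" "eta i = 0 \<or> H y $ i = 0" for i
    using c[of "Some (Inr i)"] by (auto simp: eta_def J_def zero_indices_def InrI)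
  have \<mu>: "\<mu> \<ge> 0" using c[of None] by (auto simp: \<mu>_def J_def)
  define u where "u = (\<chi> i. lam i - \<mu> * H y $ i)"
  define v where "v = (\<chi> i. eta i - \<mu> * G y $ i)"
  show thesis
  proof (rule that[of u v])
    show "w = - (nabla G y *v u) - nabla H y *v v"
      unfolding wc nabla_mult_vec using sumJ[of lam c eta \<mu>]
      by (simp add: lam_def eta_def \<mu>_def u_def v_def)
    show "u $ i * G y $ i = v $ i * H y $ i" for i
      using lam(2)[of i] eta(2)[of i] by (auto simp: u_def v_def)
    show "u $ i * v $ i \<ge> 0" for i
    proof (cases "G y $ i = 0 \<or> H y $ i = 0")
      case True
      then show ?thesis
        using lam[of i] eta[of i] by (auto simp: u_def v_def)
    next
      case False
      then have "u $ i = - (\<mu> * H y $ i)" "v $ i = - (\<mu> * G y $ i)"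
        using lam(2)[of i] eta(2)[of i] by (auto simp: u_def v_def)
      then show ?thesis using \<mu> G0[of i] H0[of i] by simp
    qed
  qed
qed

text \<open>
  The multipliers of regular normals along the sequence are coefficients with respect to the
  reduced gradients, which converge to an independent family; hence they converge where the
  constraint is active at \<open>xs\<close>. On the other indices the multiplier of the limit is zero, since
  its contribution has been absorbed by the partner with a vanishing weight.
\<close>

lemma limit_relaxed_regular_normals:
  fixes G H :: "real^'n \<Rightarrow> real^'m"
  assumes cd: "cont_differentiable G" "cont_differentiable H"
    and xs: "xs \<in> feasible_set G H" and licq: "MPCC_LICQ G H xs"
    and \<sigma>: "\<And>k. \<sigma> k > 0" and y: "\<And>k. y k \<in> relaxed_feasible_set G H (\<sigma> k)"
    and w: "\<And>k. w k \<in> regular_normal_cone (relaxed_feasible_set G H (\<sigma> k)) (y k)"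
    and lim: "y \<longlonglongrightarrow> xs" "w \<longlonglongrightarrow> w0"
  obtains u v :: "real^'m" where "w0 = - (nabla G xs *v u) - nabla H xs *v v"
    and "\<And>i. G xs $ i \<noteq> 0 \<Longrightarrow> u $ i = 0" and "\<And>i. H xs $ i \<noteq> 0 \<Longrightarrow> v $ i = 0"
    and "\<And>i. u $ i * v $ i \<ge> 0"
proof -
  let ?I = "zero_indices G xs <+> zero_indices H xs"
  let ?f = "case_sum (\<lambda>i. column i (nabla G xs)) (\<lambda>i. column i (nabla H xs))"
  have comp: "G xs $ i = 0 \<or> H xs $ i = 0" for i
  proof -
    have "(\<Sum>i\<in>UNIV. G xs $ i * H xs $ i) = 0" "\<And>i. G xs $ i \<ge> 0" "\<And>i. H xs $ i \<ge> 0"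
      using xs by (auto simp: feasible_set_def inner_vec_def less_eq_vec_def)
    then have "G xs $ i * H xs $ i = 0" by (simp add: sum_nonneg_eq_0_iff)
    then show ?thesis by simp
  qed
  have finI: "finite ?I" by simp
  have li: "lin_indep_family ?f ?I" using licq by (simp add: MPCC_LICQ_def)
  note R = reduced_gradients_tendsto[OF cd comp]
  have "\<forall>\<^sub>F z in nhds xs. G xs $ i \<noteq> 0 \<longrightarrow> G z $ i \<noteq> 0" for i
    using tendsto_imp_eventually_ne[OF tendsto_vec_nth[OF cont_differentiable_tendsto(1)[OF cd(1)]], of xs i 0]
    by (cases "G xs $ i = 0") (auto elim: eventually_mono)
  then have 1: "\<forall>\<^sub>F z in nhds xs. \<forall>i. G xs $ i \<noteq> 0 \<longrightarrow> G z $ i \<noteq> 0"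
    by (rule eventually_all_finite)
  have "\<forall>\<^sub>F z in nhds xs. H xs $ i \<noteq> 0 \<longrightarrow> H z $ i \<noteq> 0" for i
    using tendsto_imp_eventually_ne[OF tendsto_vec_nth[OF cont_differentiable_tendsto(1)[OF cd(2)]], of xs i 0]
    by (cases "H xs $ i = 0") (auto elim: eventually_mono)
  then have 2: "\<forall>\<^sub>F z in nhds xs. \<forall>i. H xs $ i \<noteq> 0 \<longrightarrow> H z $ i \<noteq> 0"
    by (rule eventually_all_finite)
  have 3: "\<forall>\<^sub>F z in nhds xs. lin_indep_family (reduced_gradients G H xs z) ?I"
    using finI li R by (rule lin_indep_family_eventually)
  define P where "P k u v \<longleftrightarrow> w k = - (\<Sum>j\<in>?I. case_sum (($) u) (($) v) j *\<^sub>R reduced_gradients G H xs (y k) j)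
      \<and> (\<forall>i. u $ i * v $ i \<ge> 0)" for k and u v :: "real^'m"
  have "\<forall>\<^sub>F z in nhds xs. (\<forall>i. G xs $ i \<noteq> 0 \<longrightarrow> G z $ i \<noteq> 0) \<and> (\<forall>i. H xs $ i \<noteq> 0 \<longrightarrow> H z $ i \<noteq> 0)
      \<and> lin_indep_family (reduced_gradients G H xs z) ?I"
    using 1 2 3 by eventually_elim simp
  from eventually_compose_filterlim[OF this lim(1)]
  have "\<forall>\<^sub>F k in sequentially. \<exists>u v. P k u v"
  proof eventually_elim
    case (elim k)
    then obtain u v where uv: "w k = - (nabla G (y k) *v u) - nabla H (y k) *v v"
      "\<And>i. u $ i * G (y k) $ i = v $ i * H (y k) $ i" "\<And>i. u $ i * v $ i \<ge> 0"
      using relaxed_regular_normal_multipliers[OF cd comp _ _ _ \<sigma> y w] by metis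
    have "w k = - (\<Sum>j\<in>?I. case_sum (($) u) (($) v) j *\<^sub>R reduced_gradients G H xs (y k) j)"
      using elim uv by (subst sum_reduced_gradients[where G = G and H = H and xs = xs, OF comp]) (auto simp: nabla_mult_vec)
    then show ?case using uv(3) unfolding P_def by blast
  qed
  then obtain N where "\<forall>k\<ge>N. \<exists>u v. P k u v" unfolding eventually_sequentially by blast
  then have "\<forall>k. \<exists>p. P (k + N) (fst p) (snd p)" by simp
  then obtain p where p: "\<And>k. P (k + N) (fst (p k)) (snd (p k))" by metis
  define c where "c k = case_sum (($) (fst (p k))) (($) (snd (p k)))" for k
  have yN: "filterlim (\<lambda>k. y (k + N)) (nhds xs) sequentially"
    using lim(1) by (rule LIMSEQ_ignore_initial_segment)
  have Rk: "(\<lambda>k. reduced_gradients G H xs (y (k + N)) j) \<longlonglongrightarrow> ?f j" if "j \<in> ?I" for j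
    using filterlim_compose[OF R[OF that] yN] .
  have "(\<lambda>k. w (k + N)) \<longlonglongrightarrow> w0" using lim(2) by (rule LIMSEQ_ignore_initial_segment)
  then have "(\<lambda>k. - w (k + N)) \<longlonglongrightarrow> - w0" by (rule tendsto_minus)
  moreover have "- w (k + N) = (\<Sum>j\<in>?I. c k j *\<^sub>R reduced_gradients G H xs (y (k + N)) j)" for k
    using p[of k] by (simp add: P_def c_def)
  ultimately have wl: "(\<lambda>k. \<Sum>j\<in>?I. c k j *\<^sub>R reduced_gradients G H xs (y (k + N)) j) \<longlonglongrightarrow> - w0" by simp
  obtain c0 where c0: "\<And>j. j \<in> ?I \<Longrightarrow> (\<lambda>k. c k j) \<longlonglongrightarrow> c0 j"
    using lin_indep_family_coeffs_tendsto[OF finI li Rk wl] by blast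
  have "(\<lambda>k. \<Sum>j\<in>?I. c k j *\<^sub>R reduced_gradients G H xs (y (k + N)) j) \<longlonglongrightarrow> (\<Sum>j\<in>?I. c0 j *\<^sub>R ?f j)"
    by (intro tendsto_intros c0 Rk)
  then have w0: "- w0 = (\<Sum>j\<in>?I. c0 j *\<^sub>R ?f j)" using wl LIMSEQ_unique by blast
  define u where "u = (\<chi> i. if G xs $ i = 0 then c0 (Inl i) else 0)"
  define v where "v = (\<chi> i. if H xs $ i = 0 then c0 (Inr i) else 0)"
  show thesis
  proof (rule that[of u v])
    have "(\<Sum>j\<in>?I. c0 j *\<^sub>R ?f j) = nabla G xs *v u + nabla H xs *v v"
      unfolding nabla_mult_vec u_def v_def
      by (simp add: sum.Plus zero_indices_def if_distrib[of "\<lambda>t. t *\<^sub>R _"] sum.If_cases cong: if_cong)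
    then show "w0 = - (nabla G xs *v u) - nabla H xs *v v"
      using w0 by (metis add.inverse_inverse minus_add_distrib diff_conv_add_uminus)
    show "u $ i = 0" if "G xs $ i \<noteq> 0" for i using that by (simp add: u_def)
    show "v $ i = 0" if "H xs $ i \<noteq> 0" for i using that by (simp add: v_def)
    show "u $ i * v $ i \<ge> 0" for i
    proof (cases "G xs $ i = 0 \<and> H xs $ i = 0")
      case True
      then have "(\<lambda>k. c k (Inl i) * c k (Inr i)) \<longlonglongrightarrow> c0 (Inl i) * c0 (Inr i)"
        by (intro tendsto_intros c0) (auto simp: zero_indices_def)
      moreover have "c k (Inl i) * c k (Inr i) \<ge> 0" for k
        using p[of k] by (simp add: P_def c_def)
      ultimately have "c0 (Inl i) * c0 (Inr i) \<ge> 0"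
        by (intro LIMSEQ_le_const[of "\<lambda>k. c k (Inl i) * c k (Inr i)"]) auto
      then show ?thesis using True by (simp add: u_def v_def)
    qed (auto simp: u_def v_def)
  qed
qed

section \<open>Limits in the objective terms\<close>

text \<open>Test the subgradient inequality at \<open>x + g\<close> and use the Lipschitz bound of each summand.\<close>

lemma subdifferential_scaled_l1_bound:
  fixes x :: "real^'n"
  assumes "\<nu> > 0" and g: "g \<in> subdifferential (scaled_l1 \<nu>) x"
  shows "norm g \<le> real CARD('n) / \<nu>"
proof -
  have "norm g * norm g = g \<bullet> (x + g - x)" by (simp add: dot_square_norm power2_eq_square)
  also have "\<dots> \<le> scaled_l1 \<nu> (x + g) - scaled_l1 \<nu> x"
    using g unfolding subdifferential_def by (smt (verit) mem_Collect_eq)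
  also have "\<dots> = (\<Sum>i\<in>UNIV. (\<bar>x $ i + g $ i\<bar> - \<bar>x $ i\<bar>) / \<nu>)"
    by (simp add: scaled_l1_def sum_subtractf diff_divide_distrib)
  also have "\<dots> \<le> (\<Sum>i\<in>(UNIV::'n set). norm g / \<nu>)"
  proof (rule sum_mono)
    fix i :: 'n
    have "\<bar>x $ i + g $ i\<bar> - \<bar>x $ i\<bar> \<le> norm g"
      using component_le_norm_cart[of g i] by linarith
    then show "(\<bar>x $ i + g $ i\<bar> - \<bar>x $ i\<bar>) / \<nu> \<le> norm g / \<nu>"
      using assms(1) by (simp add: divide_right_mono)
  qed
  also have "\<dots> = (real CARD('n) / \<nu>) * norm g" by simp
  finally have "norm g * norm g \<le> (real CARD('n) / \<nu>) * norm g" .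
  then show ?thesis
    using assms(1) by (cases "g = 0") (simp, metis mult_right_le_imp_le zero_less_norm_iff)
qed

lemma subdifferential_limit:
  assumes "continuous_on UNIV f" and "\<And>k. g k \<in> subdifferential f (x k)"
    and x: "x \<longlonglongrightarrow> x0" and g: "g \<longlonglongrightarrow> g0"
  shows "g0 \<in> subdifferential f x0"
  unfolding subdifferential_def
proof (intro CollectI allI)
  fix y
  have "isCont f x0" using assms(1) by (simp add: continuous_on_eq_continuous_at)
  then have "(\<lambda>k. f (x k)) \<longlonglongrightarrow> f x0" using x by (rule isCont_tendsto_compose)
  then have "(\<lambda>k. f (x k) + g k \<bullet> (y - x k)) \<longlonglongrightarrow> f x0 + g0 \<bullet> (y - x0)"
    by (intro tendsto_intros x g)
  moreover have "f (x k) + g k \<bullet> (y - x k) \<le> f y" for k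
    using assms(2)[of k] by (simp add: subdifferential_def)
  ultimately show "f x0 + g0 \<bullet> (y - x0) \<le> f y" by (intro LIMSEQ_le_const2) auto
qed

lemma active_theta_limit:
  assumes "\<And>k. i \<in> active_theta \<nu> (t k)" and t: "t \<longlonglongrightarrow> t0"
  shows "i \<in> active_theta \<nu> t0"
proof -
  have th: "(\<lambda>k. theta \<nu> j (t k)) \<longlonglongrightarrow> theta \<nu> j t0" for j
    by (cases "j = 1"; cases "j = 2") (simp_all add: theta_def divide_inverse, (intro tendsto_intros t)+)
  have mx: "max_theta \<nu> s = max (theta \<nu> 1 s) (max (theta \<nu> 2 s) (theta \<nu> 3 s))" for s
    by (simp add: max_theta_def)
  have "(\<lambda>k. max_theta \<nu> (t k)) \<longlonglongrightarrow> max_theta \<nu> t0"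
    unfolding mx by (intro tendsto_intros th)
  moreover have "(\<lambda>k. theta \<nu> i (t k)) = (\<lambda>k. max_theta \<nu> (t k))" and "i \<in> {1, 2, 3}"
    using assms(1) by (auto simp: active_theta_def)
  ultimately have "theta \<nu> i t0 = max_theta \<nu> t0" using th[of i] LIMSEQ_unique by auto
  then show ?thesis using \<open>i \<in> {1, 2, 3}\<close> by (simp add: active_theta_def)
qed

text \<open>
  The pieces \<open>theta \<nu> j\<close> are affine, so for a constant selection \<open>d\<close> the gradient term stays
  constant along the sequence.
\<close>

lemma theta_grad_eq: "theta_grad \<nu> d x = theta_grad \<nu> d y"
proof -
  have "deriv (theta \<nu> j) t = (if j = 1 then 0 else if j = 2 then 1 / \<nu> else - 1 / \<nu>)" for j t
  proof (rule DERIV_imp_deriv)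
    have "theta \<nu> j = (if j = 1 then (\<lambda>_. 0) else if j = 2 then (\<lambda>t. t / \<nu> - 1) else (\<lambda>t. - t / \<nu> - 1))"
      by (auto simp: theta_def fun_eq_iff)
    then show "(theta \<nu> j has_real_derivative (if j = 1 then 0 else if j = 2 then 1 / \<nu> else - 1 / \<nu>)) (at t)"
      by (auto intro!: derivative_eq_intros simp: divide_inverse)
  qed
  then show ?thesis by (simp add: theta_grad_def)
qed

lemma relaxed_limit_feasible:
  assumes "cont_differentiable G" "cont_differentiable H"
    and x: "\<And>k. x k \<in> relaxed_feasible_set G H (\<sigma> k)"
    and "x \<longlonglongrightarrow> xs" "\<sigma> \<longlonglongrightarrow> 0"
  shows "xs \<in> feasible_set G H"
proof -
  have G: "(\<lambda>k. G (x k)) \<longlonglongrightarrow> G xs" and H: "(\<lambda>k. H (x k)) \<longlonglongrightarrow> H xs"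
    using filterlim_compose[OF cont_differentiable_tendsto(1)] assms by blast+
  have "G xs $ i \<ge> 0" for i
    using tendsto_vec_nth[OF G, of i] x
    by (intro LIMSEQ_le_const) (auto simp: relaxed_feasible_set_def less_eq_vec_def)
  moreover have "H xs $ i \<ge> 0" for i
    using tendsto_vec_nth[OF H, of i] x
    by (intro LIMSEQ_le_const) (auto simp: relaxed_feasible_set_def less_eq_vec_def)
  moreover have "G xs \<bullet> H xs \<le> 0"
    using tendsto_inner[OF G H] assms(5) x
    by (intro LIMSEQ_le) (auto simp: relaxed_feasible_set_def)
  ultimately show ?thesis
    by (auto simp: feasible_set_def less_eq_vec_def inner_vec_def intro!: antisym sum_nonneg)
qed

lemma limiting_normal_approx:
  assumes "w \<in> limiting_normal_cone \<Omega> x" and "e > 0"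
  obtains y w' where "y \<in> \<Omega>" "w' \<in> regular_normal_cone \<Omega> y" "dist y x < e" "dist w' w < e"
proof -
  obtain Y W where YW: "\<And>k. Y k \<in> \<Omega> \<and> W k \<in> regular_normal_cone \<Omega> (Y k)"
    and Y: "Y \<longlonglongrightarrow> x" and W: "W \<longlonglongrightarrow> w"
    using assms(1) unfolding limiting_normal_cone_def by blast
  have "\<forall>\<^sub>F k in sequentially. dist (Y k) x < e \<and> dist (W k) w < e"
    using tendstoD[OF Y assms(2)] tendstoD[OF W assms(2)] by eventually_elim simp
  then obtain k where "dist (Y k) x < e" "dist (W k) w < e"
    by (auto dest: eventually_happens)
  then show ?thesis using that YW by blast
qed

lemma finite_range_constant_subseq:
  fixes f :: "nat \<Rightarrow> 'a"
  assumes "finite (range f)"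
  obtains r :: "nat \<Rightarrow> nat" and a where "strict_mono r" "\<And>k. f (r k) = a"
proof -
  obtain k0 where "infinite {k. f k = f k0}"
    using pigeonhole_infinite[of UNIV f] assms by auto
  then obtain r :: "nat \<Rightarrow> nat" where "strict_mono r" "\<forall>n. r n \<in> {k. f k = f k0}"
    using infinite_enumerate by blast
  then show ?thesis using that by blast
qed

section \<open>Accumulation points are lifted-stationary\<close>

theorem theorem3:
  fixes G H :: "real^'n \<Rightarrow> real^'m"
    and \<nu> :: real
    and \<sigma> \<epsilon> :: "nat \<Rightarrow> real"
    and x :: "nat \<Rightarrow> real^'n"
    and xs :: "real^'n"
  assumes "cont_differentiable G" and "cont_differentiable H"
    and "feasible_set G H \<noteq> {}" and "0 \<notin> feasible_set G H"
    and "\<nu> > 0"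
    and "approximation_method \<nu> G H \<sigma> \<epsilon> x"
    and "\<exists>r. strict_mono r \<and> (x \<circ> r) \<longlonglongrightarrow> xs"
    and "MPCC_LICQ G H xs"
  shows "lifted_stationary \<nu> G H xs"
proof -
  note cd = assms(1,2) and \<nu> = assms(5) and meth = assms(6)[unfolded approximation_method_def]
  obtain r where r: "strict_mono r" "(x \<circ> r) \<longlonglongrightarrow> xs" using assms(7) by blast
  \<comment> \<open>Approximate stationarity holds from index 1 on, so the subsequence must avoid the index 0.\<close>
  define s where "s k = r (Suc k)" for k
  have s: "strict_mono s" using r(1) by (simp add: s_def strict_mono_def)
  have s1: "s k \<ge> 1" for k
    using strict_mono_imp_increasing[OF r(1), of "Suc k"] by (simp add: s_def)
  have xlim: "(\<lambda>k. x (s k)) \<longlonglongrightarrow> xs"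
    using LIMSEQ_Suc[OF r(2)] by (simp add: s_def)
  have \<sigma>lim: "(\<lambda>k. \<sigma> (s k)) \<longlonglongrightarrow> 0" and \<epsilon>lim: "(\<lambda>k. \<epsilon> (s k)) \<longlonglongrightarrow> 0"
    using meth LIMSEQ_subseq_LIMSEQ[OF _ s] by (auto simp: comp_def)
  have "\<forall>k. \<exists>d \<zeta> g w. (\<forall>i. d i \<in> active_theta \<nu> (x (s k) $ i)) \<and> norm \<zeta> \<le> \<epsilon> (s k)
      \<and> g \<in> subdifferential (scaled_l1 \<nu>) (x (s k))
      \<and> w \<in> limiting_normal_cone (relaxed_feasible_set G H (\<sigma> (s k))) (x (s k))
      \<and> \<zeta> = g - theta_grad \<nu> d (x (s k)) + w"
    using meth s1 unfolding approx_stationary_def by meson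
  then obtain d \<zeta> g w where d: "\<And>k i. d k i \<in> active_theta \<nu> (x (s k) $ i)"
    and \<zeta>: "\<And>k. norm (\<zeta> k) \<le> \<epsilon> (s k)"
    and g: "\<And>k. g k \<in> subdifferential (scaled_l1 \<nu>) (x (s k))"
    and w: "\<And>k. w k \<in> limiting_normal_cone (relaxed_feasible_set G H (\<sigma> (s k))) (x (s k))"
    and eq: "\<And>k. \<zeta> k = g k - theta_grad \<nu> (d k) (x (s k)) + w k"
    by metis
  \<comment> \<open>Replace each limiting normal by a regular normal at a nearby point, with vanishing error.\<close>
  have "\<forall>k. \<exists>y w'. y \<in> relaxed_feasible_set G H (\<sigma> (s k))
      \<and> w' \<in> regular_normal_cone (relaxed_feasible_set G H (\<sigma> (s k))) y
      \<and> dist y (x (s k)) < inverse (real (Suc k)) \<and> dist w' (w k) < inverse (real (Suc k))"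
    using limiting_normal_approx[OF w] by (metis inverse_positive_iff_positive of_nat_0_less_iff zero_less_Suc)
  then obtain y w' where y: "\<And>k. y k \<in> relaxed_feasible_set G H (\<sigma> (s k))"
    and w': "\<And>k. w' k \<in> regular_normal_cone (relaxed_feasible_set G H (\<sigma> (s k))) (y k)"
    and yx: "\<And>k. dist (y k) (x (s k)) < inverse (real (Suc k))"
    and ww: "\<And>k. dist (w' k) (w k) < inverse (real (Suc k))"
    by metis
  have "(\<lambda>k. y k - x (s k)) \<longlonglongrightarrow> 0"
    by (rule Lim_null_comparison[OF _ LIMSEQ_inverse_real_of_nat])
      (use yx in \<open>auto simp: dist_norm intro!: always_eventually less_imp_le\<close>)
  from tendsto_add[OF this xlim] have ylim: "y \<longlonglongrightarrow> xs" by simp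
  have wlim: "(\<lambda>k. w' k - w k) \<longlonglongrightarrow> 0"
    by (rule Lim_null_comparison[OF _ LIMSEQ_inverse_real_of_nat])
      (use ww in \<open>auto simp: dist_norm intro!: always_eventually less_imp_le\<close>)
  have \<zeta>lim: "\<zeta> \<longlonglongrightarrow> 0"
    by (rule Lim_null_comparison[OF _ \<epsilon>lim]) (use \<zeta> in auto)
  \<comment> \<open>Finitely many choices of active pieces and bounded subgradients: pass to a subsequence.\<close>
  have "range d \<subseteq> UNIV \<rightarrow>\<^sub>E {1, 2, 3}"
    using d by (auto simp: active_theta_def PiE_def Pi_def extensional_def)
  then have "finite (range d)" by (rule finite_subset) (simp add: finite_PiE)
  then obtain t1 :: "nat \<Rightarrow> nat" and d0 where t1: "strict_mono t1" "\<And>k. d (t1 k) = d0"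
    by (rule finite_range_constant_subseq) blast
  have "bounded (range (g \<circ> t1))"
    using subdifferential_scaled_l1_bound[OF \<nu> g] by (auto simp: bounded_iff)
  then obtain g0 t2 where t2: "strict_mono t2" "((g \<circ> t1) \<circ> t2) \<longlonglongrightarrow> g0"
    using bounded_imp_convergent_subsequence by blast
  define t where "t = t1 \<circ> t2"
  have t: "strict_mono t" unfolding t_def using t1(1) t2(1) by (rule strict_mono_o)
  have dt: "d (t k) = d0" for k by (simp add: t_def t1)
  have glim: "(\<lambda>k. g (t k)) \<longlonglongrightarrow> g0" using t2(2) by (simp add: t_def comp_def)
  note sub = LIMSEQ_subseq_LIMSEQ[OF _ t, unfolded comp_def]
  define W where "W = theta_grad \<nu> d0 xs - g0"
  have "(\<lambda>k. \<zeta> (t k) - g (t k) + theta_grad \<nu> d0 xs + (w' (t k) - w (t k)))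
      \<longlonglongrightarrow> 0 - g0 + theta_grad \<nu> d0 xs + 0"
    by (intro tendsto_intros sub[OF \<zeta>lim] glim sub[OF wlim])
  moreover have "\<zeta> (t k) - g (t k) + theta_grad \<nu> d0 xs + (w' (t k) - w (t k)) = w' (t k)" for k
    using eq[of "t k"] theta_grad_eq[of \<nu> d0 "x (s (t k))" xs] by (simp add: dt)
  moreover have "0 - g0 + theta_grad \<nu> d0 xs + 0 = W" by (simp add: W_def)
  ultimately have Wlim: "(\<lambda>k. w' (t k)) \<longlonglongrightarrow> W" by (simp only:)
  have feas: "xs \<in> feasible_set G H"
    using relaxed_limit_feasible[OF cd y ylim \<sigma>lim] .
  have \<sigma>pos: "\<sigma> (s (t k)) > 0" for k using meth s1 by blast
  obtain u v :: "real^'m" where uv: "W = - (nabla G xs *v u) - nabla H xs *v v"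
    "\<And>i. G xs $ i \<noteq> 0 \<Longrightarrow> u $ i = 0" "\<And>i. H xs $ i \<noteq> 0 \<Longrightarrow> v $ i = 0" "\<And>i. u $ i * v $ i \<ge> 0"
    using limit_relaxed_regular_normals[OF cd feas assms(8) \<sigma>pos y w' sub[OF ylim] Wlim] by blast
  have d0: "d0 i \<in> active_theta \<nu> (xs $ i)" for i
  proof (rule active_theta_limit)
    show "d0 i \<in> active_theta \<nu> (x (s (t k)) $ i)" for k using d[of "t k" i] by (simp add: dt)
    show "(\<lambda>k. x (s (t k)) $ i) \<longlonglongrightarrow> xs $ i" by (intro tendsto_vec_nth sub[OF xlim])
  qed
  have "continuous_on UNIV (scaled_l1 \<nu> :: real^'n \<Rightarrow> real)"
    unfolding scaled_l1_def using \<nu> by (intro continuous_intros) auto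
  then have g0: "g0 \<in> subdifferential (scaled_l1 \<nu>) xs"
    by (rule subdifferential_limit[OF _ g sub[OF xlim] glim])
  have "0 = g0 - theta_grad \<nu> d0 xs - nabla G xs *v u - nabla H xs *v v"
    using uv(1) by (simp add: W_def algebra_simps)
  then show ?thesis
    unfolding lifted_stationary_def
    using feas d0 g0 uv(2-4) by (intro conjI exI[of _ d0] exI[of _ u] exI[of _ v])
      (auto simp: zero_indices_def)
qed

end
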